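(* Let $n\ge 1$ be an integer and let $C_n=n2^n+1$. If $\phi(C_n)\mid C_n-1$, where $\phi$ denotes Euler's totient function, then $C_n$ is prime.
   Context: $C_n=n2^n+1$ is called the $n$th Cullen number. *)

theory Defs
  imports "HOL-Number_Theory.Number_Theory"
begin

definition cullen :: "nat \<Rightarrow> nat" where
  "cullen n = n * 2 ^ n + 1"

end

theory Submission
  imports Defs "HOL-Computational_Algebra.Nth_Powers"
begin

text \<open>
  Write the Cullen number as \<open>C = k 2\<^sup>N + 1\<close> with \<open>k\<close> odd and \<open>k \<le> N\<close>, and suppose that it is
  composite. It is squarefree, and its prime factors are \<open>p = m 2\<^sup>e + 1\<close> with \<open>m\<close> odd, where the
  product of all the \<open>m\<close> divides \<open>k\<close>. Since \<open>\<phi>(C)\<close> properly divides \<open>C - 1\<close>, we have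
  \<open>C / \<phi>(C) > 2\<close>, and even \<open>> 4\<close> if \<open>3\<close> divides \<open>C\<close>, as then \<open>(C - 1) / \<phi>(C) \<equiv> 1\<close> modulo 3.
  If \<open>k\<close> is small, there are too few primes with \<open>m > 1\<close> for this. If \<open>k\<close> is large, combining
  \<open>m 2\<^sup>e \<equiv> -1\<close> and \<open>k 2\<^sup>N \<equiv> -1\<close> modulo \<open>p\<close> gives \<open>e \<le> 2 + log\<^sub>2 k + (N / e) log\<^sub>2 m\<close>,
  with at most one exception, for which still \<open>e \<le> N / 3\<close>. Then the exponents \<open>e\<close> are too small
  for the product of the primes to reach \<open>C\<close>.
\<close>

section \<open>Equal powers, and divisors of numbers \<open>k * 2 ^ N + 1\<close>\<close>

text \<open>For the coprime exponents \<open>a'\<close> and \<open>b'\<close>, \<open>x\<close> is a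
  power \<open>z ^ b'\<close>. As \<open>b'\<close> is odd, \<open>z + 1\<close> divides the prime
  \<open>x + 1\<close>, which forces \<open>b' = 1\<close>; then \<open>x + 1\<close> divides the
  prime \<open>y + 1\<close>. This will make the exceptional prime unique.\<close>

lemma odd_power_eq_imp_eq:
  fixes x y a b :: nat
  assumes eq: "x ^ a = y ^ b" and "odd a" "odd b"
    and "prime (x + 1)" "prime (y + 1)" and "x \<ge> 2" "y \<ge> 2"
  shows "x = y"
proof -
  define d where "d = gcd a b"
  have "d > 0"
    using \<open>odd a\<close> by (auto simp: d_def intro: Nat.gr0I)
  obtain a' b' where a': "a = a' * d" and b': "b = b' * d" and "coprime a' b'"
    using gcd_coprime_exists[of a b] \<open>d > 0\<close> unfolding d_def by auto
  have "odd a'" "odd b'" using \<open>odd a\<close> \<open>odd b\<close> a' b' by auto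
  then have pos: "a' > 0" "b' > 0" by (auto intro: Nat.gr0I)
  have "(x ^ a') ^ d = (y ^ b') ^ d"
    using eq by (simp add: a' b' power_mult)
  then have eq': "x ^ a' = y ^ b'"
    using \<open>d > 0\<close> by (simp add: power_eq_iff_eq_base)
  have "is_nth_power b' x"
    unfolding is_nth_power_conv_multiplicity_nat[OF pos(2)]
  proof (intro allI impI)
    fix p :: nat assume p: "prime p"
    have "a' * multiplicity p x = b' * multiplicity p y"
      using arg_cong[OF eq', of "multiplicity p"] p \<open>x \<ge> 2\<close> \<open>y \<ge> 2\<close>
      by (simp add: prime_elem_multiplicity_power_distrib)
    then have "b' dvd a' * multiplicity p x" by simp
    then show "b' dvd multiplicity p x"
      using \<open>coprime a' b'\<close> by (simp add: coprime_commute coprime_dvd_mult_right_iff)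
  qed
  then obtain z where z: "x = z ^ b'" by (auto elim: is_nth_powerE)
  have odd_dvd: "u + 1 dvd u ^ j + 1" if "odd j" for u j :: nat
  proof -
    have "[int u ^ j + 1 = (-1) ^ j + 1] (mod (int u + 1))"
      by (intro cong_add cong_pow cong_refl) (simp add: cong_iff_dvd_diff)
    then have "int u + 1 dvd int u ^ j + 1"
      using \<open>odd j\<close> by (simp add: cong_iff_dvd_diff)
    then have "int (u + 1) dvd int (u ^ j + 1)" by (simp add: add.commute)
    then show ?thesis by (simp only: of_nat_dvd_iff)
  qed
  have "z > 0" using z \<open>x \<ge> 2\<close> pos by (auto intro!: Nat.gr0I simp: power_0_left)
  have "z + 1 dvd x + 1" using odd_dvd[OF \<open>odd b'\<close>, of z] z by simp
  then have "x = z"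
    using \<open>prime (x + 1)\<close> \<open>z > 0\<close> by (auto simp: prime_nat_iff)
  then have "x ^ b' = x ^ 1" using z by simp
  then have "b' = 1" using \<open>x \<ge> 2\<close> by (subst (asm) power_inject_exp) auto
  then have "x + 1 dvd y + 1" using odd_dvd[OF \<open>odd a'\<close>, of x] eq' by simp
  then show ?thesis
    using \<open>prime (y + 1)\<close> \<open>x \<ge> 2\<close> by (auto simp: prime_nat_iff)
qed

text \<open>
  Write \<open>N = q e + r\<close> with \<open>r < e\<close> and let \<open>p\<close> be the given divisor. Substituting
  \<open>m 2\<^sup>e \<equiv> -1\<close> in \<open>k 2\<^sup>N \<equiv> -1\<close> shows that \<open>p\<close> divides both \<open>m\<^sup>q \<plusminus> k 2\<^sup>r\<close> and
  \<open>m\<^bsup>q+1\<^esup> 2\<^bsup>e-r\<^esup> \<plusminus> k\<close>. The first vanishes only in the excluded case, the second is odd;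
  and if \<open>p\<close> were large, the two size bounds would contradict each other.
\<close>

lemma proth_factor_bound:
  fixes k m e N :: nat
  assumes dvd: "m * 2 ^ e + 1 dvd k * 2 ^ N + 1" and "odd k" "odd m" "e > 0"
    and nz: "\<And>q. odd q \<Longrightarrow> (m * 2 ^ e) ^ q \<noteq> k * 2 ^ N"
  shows "m * 2 ^ e \<le> 4 * k * m ^ (N div e)"
proof (rule ccontr)
  define q r where "q = N div e" and "r = N mod e"
  have N: "N = q * e + r" and "r < e" using \<open>e > 0\<close> by (simp_all add: q_def r_def)
  define P where "P = int (m * 2 ^ e + 1)"
  define D1 where "D1 = (-1) ^ q * int k * 2 ^ r + int m ^ q"
  define D2 where "D2 = int m ^ (q + 1) * 2 ^ (e - r) - (-1) ^ q * int k"
  have P: "P dvd int (k * 2 ^ N + 1)"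
    unfolding P_def using dvd by (simp only: of_nat_dvd_iff)
  have c: "[int m * 2 ^ e = -1] (mod P)"
    by (simp add: cong_iff_dvd_diff P_def add.commute)
  have "int m ^ q * int (k * 2 ^ N + 1) = (int m * 2 ^ e) ^ q * (int k * 2 ^ r) + int m ^ q"
    by (simp add: N power_add power_mult power_mult_distrib algebra_simps)
  moreover have "[\<dots> = (-1) ^ q * (int k * 2 ^ r) + int m ^ q] (mod P)"
    by (intro cong_add cong_mult cong_pow c cong_refl)
  moreover have "P dvd int m ^ q * int (k * 2 ^ N + 1)" using P by simp
  ultimately have P1: "P dvd D1"
    unfolding D1_def by (simp add: mult.assoc cong_dvd_iff[of _ _ P])
  have "2 ^ e = (2::int) ^ r * 2 ^ (e - r)" using \<open>r < e\<close> by (simp flip: power_add)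
  then have "D1 * int m * 2 ^ (e - r) =
      (int m * 2 ^ e) * ((-1) ^ q * int k) + int m ^ (q + 1) * 2 ^ (e - r)"
    by (simp add: D1_def algebra_simps)
  moreover have "[\<dots> = (-1) * ((-1) ^ q * int k) + int m ^ (q + 1) * 2 ^ (e - r)] (mod P)"
    by (intro cong_add cong_mult c cong_refl)
  moreover have "P dvd D1 * int m * 2 ^ (e - r)" using P1 by simp
  ultimately have P2: "P dvd D2"
    unfolding D2_def by (simp add: cong_dvd_iff[of _ _ P])
  have "odd D2" using \<open>odd k\<close> \<open>r < e\<close> by (simp add: D2_def)
  have "D1 \<noteq> 0"
  proof (cases "r = 0")
    case False
    then have "odd D1" using \<open>odd m\<close> by (simp add: D1_def)
    then show ?thesis by auto
  next
    case True
    show ?thesis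
    proof
      assume "D1 = 0"
      then have *: "int m ^ q = - ((-1) ^ q * int k)" by (simp add: D1_def True)
      have "m > 0" using \<open>odd m\<close> by (auto intro: Nat.gr0I)
      then have "int m ^ q > 0" by simp
      then have "odd q" using * by (auto simp: uminus_power_if split: if_splits)
      then have "int m ^ q = int k" using * by simp
      then have "m ^ q = k" by (simp flip: of_nat_power)
      then have "(m * 2 ^ e) ^ q = k * 2 ^ N"
        by (simp add: N True power_mult_distrib power_mult[symmetric] mult.commute)
      then show False using nz[OF \<open>odd q\<close>] by simp
    qed
  qed
  then have "P \<le> \<bar>D1\<bar>" using P1 by (simp add: zdvd_imp_le)
  also have "\<dots> \<le> int k * 2 ^ r + int m ^ q"
    unfolding D1_def by (rule order_trans[OF abs_triangle_ineq]) (simp add: abs_mult power_abs)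
  finally have "int (m * 2 ^ e) < int (k * 2 ^ r + m ^ q)" by (simp add: P_def)
  then have 1: "m * 2 ^ e < k * 2 ^ r + m ^ q" by (simp only: of_nat_less_iff)
  have "P \<le> \<bar>D2\<bar>" using P2 \<open>odd D2\<close> by (intro zdvd_imp_le) auto
  also have "\<dots> \<le> int m ^ (q + 1) * 2 ^ (e - r) + int k"
    unfolding D2_def by (rule order_trans[OF abs_triangle_ineq4]) (simp add: abs_mult power_abs)
  finally have "int (m * 2 ^ e) < int (m ^ (q + 1) * 2 ^ (e - r) + k)" by (simp add: P_def)
  then have 2: "m * 2 ^ e < m ^ (q + 1) * 2 ^ (e - r) + k" by (simp only: of_nat_less_iff)
  assume "\<not> m * 2 ^ e \<le> 4 * k * m ^ (N div e)"
  then have 0: "4 * (k * m ^ q) < m * 2 ^ e" by (simp add: q_def)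
  have pos: "k \<ge> 1" "m ^ q \<ge> 1" using \<open>odd k\<close> \<open>odd m\<close> by (auto intro!: Suc_leI Nat.gr0I)
  \<comment> \<open>Both \<open>m ^ q\<close> and \<open>k\<close> are below a quarter of
    \<open>m * 2 ^ e\<close>, so \<open>k * 2 ^ r\<close> and
    \<open>m ^ (q + 1) * 2 ^ (e - r)\<close> exceed three quarters of it. Their product then makes
    \<open>k * m ^ q\<close> larger than 9/16 of \<open>m * 2 ^ e\<close>.\<close>
  have "4 * m ^ q \<le> 4 * (k * m ^ q)" using pos by simp
  then have 3: "3 * (m * 2 ^ e) < 4 * (k * 2 ^ r)" using 0 1 by linarith
  have "4 * k \<le> 4 * (k * m ^ q)" using pos by simp
  then have "3 * (m * 2 ^ e) < 4 * (m ^ (q + 1) * 2 ^ (e - r))" using 0 2 by linarith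
  moreover have e: "(2::nat) ^ e = 2 ^ (e - r) * 2 ^ r" using \<open>r < e\<close> by (simp flip: power_add)
  ultimately have "(m * 2 ^ (e - r)) * (3 * 2 ^ r) < (m * 2 ^ (e - r)) * (4 * m ^ q)"
    by (simp add: algebra_simps)
  then have "3 * 2 ^ r < 4 * m ^ q" by (metis mult_less_cancel1)
  then have "k * (3 * 2 ^ r) \<le> k * (4 * m ^ q)" by (intro mult_le_mono2) simp
  then have "3 * (k * 2 ^ r) \<le> 4 * (k * m ^ q)" by (simp only: mult.left_commute)
  then show False using 0 3 by linarith
qed

section \<open>Auxiliary estimates and small primes\<close>

text \<open>After division by \<open>c\<close>, factors in \<open>A\<close> are at least 1 and the
  others at most 1, so all of \<open>A\<close> may be included and the rest dropped.\<close>

lemma prod_le_exceptional: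
  fixes f :: "'a \<Rightarrow> real"
  assumes "finite R" "finite A" and "c \<ge> 1" and "card R \<le> d"
    and le: "\<And>x. x \<in> R - A \<Longrightarrow> 0 \<le> f x \<and> f x \<le> c"
    and ge: "\<And>x. x \<in> A \<Longrightarrow> f x \<ge> c"
  shows "prod f R \<le> (\<Prod>x\<in>A. f x / c) * c ^ d"
proof -
  have nonneg: "f x / c \<ge> 0" if "x \<in> R \<union> A" for x
    using that le[of x] ge[of x] \<open>c \<ge> 1\<close> by (cases "x \<in> A") auto
  have "prod f R = (\<Prod>x\<in>R. f x / c) * c ^ card R"
    using \<open>c \<ge> 1\<close> by (simp add: prod_dividef)
  also have "(\<Prod>x\<in>R. f x / c) = (\<Prod>x\<in>R \<inter> A. f x / c) * (\<Prod>x\<in>R - A. f x / c)"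
    using \<open>finite R\<close> by (rule prod.Int_Diff)
  also have "\<dots> \<le> (\<Prod>x\<in>A. f x / c) * 1"
  proof (rule mult_mono)
    show "(\<Prod>x\<in>R \<inter> A. f x / c) \<le> (\<Prod>x\<in>A. f x / c)"
      using \<open>finite A\<close> \<open>c \<ge> 1\<close> ge nonneg by (intro prod_mono2) auto
    show "(\<Prod>x\<in>R - A. f x / c) \<le> 1"
      using le \<open>c \<ge> 1\<close> by (intro prod_le_1) auto
  qed (use nonneg in \<open>auto intro!: prod_nonneg\<close>)
  also have "(\<Prod>x\<in>A. f x / c) * 1 * c ^ card R \<le> (\<Prod>x\<in>A. f x / c) * 1 * c ^ d"
    using nonneg \<open>c \<ge> 1\<close> \<open>card R \<le> d\<close>
    by (intro mult_left_mono power_increasing) (auto intro!: prod_nonneg)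
  finally show ?thesis using \<open>c \<ge> 1\<close> by (simp add: mult_right_mono)
qed

lemma prime_dvd_prime_nat: "prime p \<Longrightarrow> prime q \<Longrightarrow> q dvd p \<Longrightarrow> p = q" for p q :: nat
  using primes_dvd_imp_eq by blast

text \<open>Every other value in this range is a proper multiple of 3, 5 or 17.\<close>

lemma prime_two_power_plus_1:
  assumes "prime (2 ^ j + 1 :: nat)" "0 < j" "j < 14"
  shows "2 ^ j + 1 \<in> {3, 5, 17, 257::nat}"
proof -
  have q: "q dvd 2 ^ j + 1 \<longrightarrow> 2 ^ j + 1 = q" if "prime q" for q :: nat
    using prime_dvd_prime_nat[OF assms(1) that] by blast
  have "prime (3::nat)" "prime (5::nat)" "prime (17::nat)" by simp_all
  note q = this[THEN q]
  have "j \<in> {1, 2, 3, 4, 5, 6, 7, 8, 9, 10, 11, 12, 13}"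
    using assms unfolding insert_iff empty_iff by presburger
  then show ?thesis
    using q unfolding insert_iff empty_iff by (elim disjE FalseE) simp_all
qed

lemma prime_less_31:
  assumes "prime (p::nat)" "p < 31"
  shows "p \<in> {2, 3, 5, 7, 11, 13, 17, 19, 23, 29}"
proof -
  have "2 dvd p \<longrightarrow> p = 2" "3 dvd p \<longrightarrow> p = 3" "5 dvd p \<longrightarrow> p = 5"
    using prime_dvd_prime_nat[OF assms(1)] by simp_all
  moreover have "p \<in> {2, 3, 4, 5, 6, 7, 8, 9, 10, 11, 12, 13, 14, 15, 16,
      17, 18, 19, 20, 21, 22, 23, 24, 25, 26, 27, 28, 29, 30}"
    using assms(2) prime_ge_2_nat[OF assms(1)] unfolding insert_iff empty_iff by presburger
  ultimately show ?thesis
    unfolding insert_iff empty_iff by (elim disjE FalseE) simp_all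
qed

text \<open>The left side will bound \<open>N\<close> when \<open>k\<close> has \<open>l\<close>
  binary digits, while \<open>N \<ge> k \<ge> 2 ^ (l - 1)\<close>. The inequality still fails at
  \<open>l = 11\<close>.\<close>

lemma quadratic_less_power:
  "l \<ge> 12 \<Longrightarrow> 11 * l ^ 2 + 21 * l + 21 < (2::nat) ^ (l - 1)"
proof (induction l rule: dec_induct)
  case (step l)
  then have "12 * l \<le> l ^ 2" by (simp add: power2_eq_square)
  then have "22 * l + 32 \<le> 2 ^ (l - 1)" using step by linarith
  moreover have "(2::nat) ^ l = 2 * 2 ^ (l - 1)" using step by (cases l) auto
  ultimately show ?case using step by (simp add: power2_eq_square algebra_simps)
qed simp

section \<open>Prime factors of a composite counterexample\<close>

text \<open>Of the Cullen form only \<open>k \<le> N\<close> is kept.\<close>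

locale lehmer_proth =
  fixes k N :: nat
  assumes odd_k: "odd k" and k_le_N: "k \<le> N"
    and lehmer: "totient (k * 2 ^ N + 1) dvd k * 2 ^ N"
    and not_prime: "\<not> prime (k * 2 ^ N + 1)"
begin

definition "C = k * 2 ^ N + 1"
definition "S = prime_factors C"
definition "e p = multiplicity 2 (p - 1)" for p :: nat
definition "m p = (p - 1) div 2 ^ e p" for p :: nat
text \<open>
  The exceptional case of \<open>proth_factor_bound\<close>: \<open>C\<close> has the algebraic factor \<open>(p - 1) + 1\<close>.
\<close>

definition "exceptional p \<longleftrightarrow> (\<exists>q. odd q \<and> (p - 1) ^ q = k * 2 ^ N)" for p :: nat

lemma k_pos: "k \<ge> 1"
  using odd_k by (auto intro!: Suc_leI Nat.gr0I)

lemma N_pos: "N \<ge> 1"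
  using k_pos k_le_N by simp

lemma C_gt_1: "C > 1"
  using k_pos by (simp add: C_def)

lemma finite_S [simp]: "finite S"
  by (simp add: S_def)

lemma S_prime: "p \<in> S \<Longrightarrow> prime p"
  by (auto simp: S_def)

lemma S_dvd: "p \<in> S \<Longrightarrow> p dvd C"
  by (auto simp: S_def)

lemma S_iff: "p \<in> S \<longleftrightarrow> prime p \<and> p dvd C"
  using C_gt_1 by (auto simp: S_def prime_factors_dvd)

lemma S_not_dvd: "p \<in> S \<Longrightarrow> \<not> p dvd k * 2 ^ N"
proof
  assume "p \<in> S" "p dvd k * 2 ^ N"
  then have "p dvd C - k * 2 ^ N" by (intro dvd_diff_nat S_dvd)
  then show False using S_prime[OF \<open>p \<in> S\<close>] by (simp add: C_def)
qed

text \<open>If \<open>p ^ 2\<close> divided \<open>C\<close>, then \<open>p\<close> would divide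
  \<open>totient C\<close> and hence \<open>C - 1\<close>.\<close>

lemma multiplicity_C: "p \<in> S \<Longrightarrow> multiplicity p C = 1"
proof (rule ccontr)
  assume p: "p \<in> S" and "multiplicity p C \<noteq> 1"
  moreover have "multiplicity p C > 0"
    using p S_dvd S_prime C_gt_1 by (simp add: prime_multiplicity_gt_zero_iff)
  ultimately have "multiplicity p C \<ge> 2" by simp
  then have "p ^ 2 dvd C" by (rule multiplicity_dvd')
  then have "totient (p ^ 2) dvd totient C" by (rule totient_dvd)
  then have "p * (p - 1) dvd k * 2 ^ N"
    using lehmer S_prime[OF p] by (simp add: totient_prime_power C_def dvd_trans)
  then show False using S_not_dvd[OF p] by (meson dvd_mult_left)
qed

lemma C_prod: "C = \<Prod>S"
proof -
  have "C = (\<Prod>p\<in>S. p ^ multiplicity p C)"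
    unfolding S_def using C_gt_1 by (intro prime_factorization_nat) simp
  then show ?thesis by (simp add: multiplicity_C)
qed

lemma totient_C: "totient C = (\<Prod>p\<in>S. p - 1)"
  using C_gt_1 multiplicity_C by (simp add: totient_formula1 S_def)

lemma S_odd: "p \<in> S \<Longrightarrow> odd p"
  using dvd_trans[OF _ S_dvd, of 2 p] N_pos by (auto simp: C_def)

lemma S_ge_3: "p \<in> S \<Longrightarrow> p \<ge> 3"
  using S_odd[of p] prime_ge_2_nat[OF S_prime[of p]] by (cases "p = 2") auto

lemma pred_eq: "p \<in> S \<Longrightarrow> p - 1 = m p * 2 ^ e p"
  by (simp add: m_def e_def multiplicity_dvd)

lemma odd_m: "p \<in> S \<Longrightarrow> odd (m p)"
  using S_ge_3[of p] multiplicity_decompose[of "p - 1" 2] by (simp add: m_def e_def)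

lemma m_pos: "p \<in> S \<Longrightarrow> m p \<ge> 1"
  using odd_m[of p] by (auto intro!: Suc_leI Nat.gr0I)

lemma m_ge_3: "p \<in> S \<Longrightarrow> m p \<noteq> 1 \<Longrightarrow> m p \<ge> 3"
  using odd_m[of p] m_pos[of p] by (cases "m p = 2") auto

lemma e_pos: "p \<in> S \<Longrightarrow> e p > 0"
proof (rule Nat.gr0I)
  assume "p \<in> S" "e p = 0"
  then have "odd (p - 1)" using pred_eq[of p] odd_m[of p] by simp
  then show False using S_odd[OF \<open>p \<in> S\<close>] by simp
qed

lemma S_eq: "p \<in> S \<Longrightarrow> p = m p * 2 ^ e p + 1"
  using pred_eq[of p] S_ge_3[of p] by linarith

lemma pred_dvd: "p \<in> S \<Longrightarrow> p - 1 dvd k * 2 ^ N"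
proof -
  assume "p \<in> S"
  then have "p - 1 dvd totient C" unfolding totient_C by (intro dvd_prodI) auto
  then show ?thesis using lehmer by (simp add: C_def dvd_trans)
qed

text \<open>The product is the odd part of \<open>totient C\<close>, which divides
  \<open>k * 2 ^ N\<close>.\<close>

lemma prod_m_dvd: "prod m S dvd k"
proof -
  have "totient C = prod m S * (\<Prod>p\<in>S. 2 ^ e p)"
    unfolding totient_C prod.distrib[symmetric] by (intro prod.cong refl pred_eq)
  then have "prod m S dvd k * 2 ^ N"
    using lehmer by (metis C_def dvd_mult_left)
  moreover have "coprime (prod m S) (2 ^ N)"
    by (simp add: even_prod_iff odd_m)
  ultimately show ?thesis by (simp add: coprime_dvd_mult_left_iff)
qed

lemma prod_m_le: "prod m S \<le> k"
  using prod_m_dvd k_pos by (intro dvd_imp_le) auto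

section \<open>Exceptional and ordinary prime factors\<close>

lemma exceptional_unique:
  assumes "p \<in> S" "exceptional p" "p' \<in> S" "exceptional p'"
  shows "p = p'"
proof -
  obtain q where q: "odd q" "(p - 1) ^ q = k * 2 ^ N"
    using assms(2) unfolding exceptional_def by blast
  obtain q' where q': "odd q'" "(p' - 1) ^ q' = k * 2 ^ N"
    using assms(4) unfolding exceptional_def by blast
  have "p - 1 = p' - 1"
  proof (rule odd_power_eq_imp_eq)
    show "(p - 1) ^ q = (p' - 1) ^ q'" using q q' by simp
  qed (use assms S_ge_3[of p] S_ge_3[of p'] S_prime q q' in simp_all)
  then show ?thesis using S_ge_3[of p] S_ge_3[of p'] assms by linarith
qed

lemma not_exceptional_bound:
  assumes "p \<in> S" "\<not> exceptional p"
  shows "m p * 2 ^ e p \<le> 4 * k * m p ^ (N div e p)"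
proof (rule proth_factor_bound)
  show "m p * 2 ^ e p + 1 dvd k * 2 ^ N + 1"
    using S_dvd[OF assms(1)] S_eq[OF assms(1)] by (simp add: C_def)
  show "(m p * 2 ^ e p) ^ q \<noteq> k * 2 ^ N" if "odd q" for q
    using that assms pred_eq[OF assms(1)] by (auto simp: exceptional_def)
qed (use assms odd_k odd_m e_pos in auto)

text \<open>The powers of 2 in \<open>(p - 1) ^ q = k * 2 ^ N\<close> give
  \<open>N = q * e p\<close>. The odd number \<open>q\<close> is not 1, since otherwise
  \<open>C = p\<close> would be prime.\<close>

lemma exceptional_e_le:
  assumes "p \<in> S" "exceptional p"
  shows "3 * e p \<le> N"
proof -
  obtain q where q: "odd q" "(p - 1) ^ q = k * 2 ^ N"
    using assms by (auto simp: exceptional_def)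
  have "q \<noteq> 1"
  proof
    assume "q = 1"
    then have "p = C" using q S_ge_3[OF assms(1)] by (simp add: C_def)
    then show False using S_prime[OF assms(1)] not_prime by (simp add: C_def)
  qed
  then have "q \<ge> 3" using q(1) by (cases "q = 2") (auto simp: Suc_le_eq intro: Nat.gr0I elim!: oddE)
  have "multiplicity 2 ((p - 1) ^ q) = q * e p"
    using S_ge_3[OF assms(1)] by (simp add: e_def prime_elem_multiplicity_power_distrib)
  moreover have "multiplicity 2 (k * 2 ^ N) = N"
    using odd_k k_pos by (simp add: prime_elem_multiplicity_mult_distrib not_dvd_imp_multiplicity_0)
  ultimately have "N = q * e p" using q by simp
  then show ?thesis using \<open>q \<ge> 3\<close> by simp
qed

section \<open>Lower bounds for \<open>C / totient C\<close>\<close>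

lemma two_totient_less: "2 * totient C < C"
proof -
  obtain g where g: "k * 2 ^ N = totient C * g" using lehmer by (auto simp: C_def)
  have "g \<noteq> 0" using g k_pos by (intro notI) simp
  moreover have "g \<noteq> 1"
    using g not_prime totient_imp_prime[of C] C_gt_1 by (auto simp: C_def)
  ultimately have "totient C * 2 \<le> k * 2 ^ N" unfolding g by (intro mult_le_mono2) simp
  then show ?thesis by (simp add: C_def)
qed

text \<open>For a prime factor \<open>p \<noteq> 3\<close>, 3 divides neither \<open>p\<close> nor
  \<open>p - 1\<close>, so \<open>p - 1\<close> is 1 modulo 3 and \<open>totient C\<close> is 2
  modulo 3. Hence the quotient \<open>g\<close> is 1 modulo 3, but it is not 1.\<close>

lemma four_totient_less:
  assumes "3 dvd C"
  shows "4 * totient C < C"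
proof -
  have 3: "3 \<in> S" using assms by (simp add: S_iff)
  obtain g where g: "k * 2 ^ N = totient C * g" using lehmer by (auto simp: C_def)
  have "[p - 1 = 1] (mod 3)" if p: "p \<in> S - {3}" for p
  proof -
    have "\<not> 3 dvd p" using p S_prime[of p] by (auto simp: prime_nat_iff)
    moreover have "\<not> 3 dvd p - 1" using p pred_dvd[of p] S_not_dvd[OF 3] by (meson DiffD1 dvd_trans)
    moreover obtain j where j: "p = Suc j" using p S_ge_3[of p] by (cases p) auto
    ultimately have "\<not> 3 dvd Suc j" "\<not> 3 dvd j" by simp_all
    then have "j mod 3 = 1" by presburger
    then show ?thesis by (simp add: cong_def j)
  qed
  then have "[(\<Prod>p\<in>S - {3}. p - 1) = (\<Prod>p\<in>S - {3}. 1)] (mod 3)"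
    by (intro cong_prod)
  then have "[totient C = 2] (mod 3)"
    using cong_scalar_left[of _ "1::nat" 3 2] unfolding totient_C prod.remove[OF finite_S 3] by simp
  then have "[totient C * g + 1 = 2 * g + 1] (mod 3)"
    by (intro cong_add cong_mult cong_refl)
  moreover have "[totient C * g + 1 = 0] (mod 3)"
    using assms unfolding g[symmetric] by (simp add: cong_0_iff C_def)
  ultimately have "[2 * g + 1 = 0] (mod 3)" by (rule cong_trans[OF cong_sym])
  then have "3 dvd 2 * g + 1" by (simp only: cong_0_iff)
  moreover have "g \<noteq> 1"
    using g not_prime totient_imp_prime[of C] C_gt_1 by (auto simp: C_def)
  ultimately have "g \<ge> 4" by presburger
  then have "totient C * 4 \<le> k * 2 ^ N" unfolding g by (intro mult_le_mono2)
  then show ?thesis by (simp add: C_def)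
qed

section \<open>Small \<open>k\<close>: upper bounds for \<open>C / totient C\<close>\<close>

text \<open>The removed numbers are the Fermat primes below \<open>2 ^ 14\<close>.\<close>

definition "R = S - {3, 5, 17, 257}"

text \<open>A non-exceptional \<open>p\<close> would satisfy
  \<open>2 ^ e p \<le> 4 * k < 2 ^ 14\<close> and so be one of the removed primes. For an
  exceptional one, the odd number \<open>k\<close> divides a power of 2.\<close>

lemma m_eq_1_in_R:
  assumes "k < 2187" "p \<in> R" "m p = 1"
  shows "k = 1 \<and> exceptional p"
proof -
  have p: "p \<in> S" using assms by (simp add: R_def)
  have p_eq: "p - 1 = 2 ^ e p" using pred_eq[OF p] assms by simp
  have "exceptional p"
  proof (rule ccontr)
    assume "\<not> exceptional p"
    then have "2 ^ e p \<le> 4 * k" using not_exceptional_bound[OF p] assms by simp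
    then have "(2::nat) ^ e p < 2 ^ 14" using assms by simp
    then have "e p < 14" by (subst (asm) power_strict_increasing_iff) auto
    moreover have "p = 2 ^ e p + 1" using S_eq[OF p] unfolding assms(3) by simp
    ultimately have "p \<in> {3, 5, 17, 257}"
      using S_prime[OF p] e_pos[OF p] by (metis prime_two_power_plus_1)
    then show False using assms(2) by (simp add: R_def)
  qed
  moreover from this obtain q where "(p - 1) ^ q = k * 2 ^ N" by (auto simp: exceptional_def)
  then have "k dvd 2 ^ (e p * q)" using p_eq by (simp add: power_mult)
  moreover have "coprime k (2 ^ (e p * q))" using odd_k by simp
  ultimately show ?thesis using coprime_common_divisor_nat by (metis dvd_refl nat_dvd_1_iff_1)
qed

text \<open>For \<open>k \<noteq> 1\<close>, each member of \<open>R\<close> contributes a factor of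
  at least 3 to \<open>prod m S \<le> k < 3 ^ 7\<close>. For \<open>k = 1\<close>, all members are
  exceptional, so there is at most one.\<close>

lemma card_R_le:
  assumes "k < 2187"
  shows "card R \<le> 6"
proof (cases "k = 1")
  case True
  have "m p = 1" if "p \<in> R" for p
  proof -
    have "p \<in> S" using that by (simp add: R_def)
    then have "m p dvd prod m S" by (intro dvd_prodI) auto
    then show ?thesis using prod_m_dvd True by (metis dvd_trans nat_dvd_1_iff_1)
  qed
  then have "\<forall>p\<in>R. \<forall>p'\<in>R. p = p'"
    using m_eq_1_in_R[OF assms] exceptional_unique unfolding R_def by blast
  moreover have "finite R" by (simp add: R_def)
  ultimately have "card R \<le> Suc 0" by (simp only: card_le_Suc0_iff_eq)
  then show ?thesis by simp
next
  case False
  have "3 ^ card R = (\<Prod>p\<in>R. 3::nat)" by simp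
  also have "\<dots> \<le> prod m R"
    using m_eq_1_in_R[OF assms] False m_ge_3 by (intro prod_mono) (force simp: R_def)
  also have "\<dots> \<le> prod m S"
  proof (rule dvd_imp_le)
    show "prod m R dvd prod m S" by (intro prod_dvd_prod_subset) (auto simp: R_def)
    show "prod m S > 0" using m_pos by (auto intro!: prod_pos simp: Suc_le_eq)
  qed
  also have "\<dots> < 3 ^ 7" using prod_m_le assms by simp
  finally have "card R < 7" by (subst (asm) power_strict_increasing_iff) auto
  then show ?thesis by simp
qed

abbreviation ratio :: "nat \<Rightarrow> real" where "ratio p \<equiv> 1 + 1 / real (p - 1)"

lemma C_eq_totient_mult_prod_ratio: "real C = real (totient C) * prod ratio S"
proof -
  have "real C = (\<Prod>p\<in>S. real p)" unfolding C_prod by simp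
  also have "\<dots> = (\<Prod>p\<in>S. real (p - 1) * ratio p)"
  proof (intro prod.cong refl)
    fix p assume "p \<in> S"
    then have eq: "real p = real (p - 1) + 1" and pos: "real (p - 1) > 0"
      using S_ge_3[of p] by auto
    have "x + 1 = x * (1 + 1 / x)" if "x > 0" for x :: real
      using that by (simp add: field_simps)
    from eq this[OF pos] show "real p = real (p - 1) * ratio p" by (rule trans)
  qed
  finally show ?thesis by (simp add: prod.distrib totient_C)
qed

lemma less_prod_ratio:
  assumes "c * totient C < C"
  shows "real c < prod ratio S"
proof -
  have "real (c * totient C) < real C" using assms by (simp only: of_nat_less_iff)
  then have "real c * real (totient C) < real (totient C) * prod ratio S"
    by (simp only: C_eq_totient_mult_prod_ratio of_nat_mult)
  then show ?thesis using C_gt_1 by (simp add: mult.commute)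
qed

text \<open>\<open>F\<close> covers the removed primes and \<open>A\<close> the members of
  \<open>R\<close> below \<open>b\<close>. Any further member contributes at most
  \<open>c = b / (b - 1)\<close>, and \<open>R\<close> has at most six.\<close>

lemma prod_ratio_le:
  assumes k: "k < 2187" and F: "S \<inter> {3, 5, 17, 257} \<subseteq> F" "finite F"
    and A: "finite A" "\<And>p. p \<in> A \<Longrightarrow> ratio p \<ge> c"
    and c: "c = 1 + 1 / (real b - 1)" "b \<ge> 2" and R: "\<And>p. p \<in> R \<Longrightarrow> p < b \<Longrightarrow> p \<in> A"
  shows "prod ratio S \<le> prod ratio F * ((\<Prod>p\<in>A. ratio p / c) * c ^ 6)"
proof -
  have "prod ratio S = prod ratio (S \<inter> {3, 5, 17, 257}) * prod ratio R"
    unfolding R_def by (rule prod.Int_Diff) simp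
  also have "\<dots> \<le> prod ratio F * ((\<Prod>p\<in>A. ratio p / c) * c ^ 6)"
  proof (rule mult_mono)
    show "prod ratio (S \<inter> {3, 5, 17, 257}) \<le> prod ratio F"
      using F by (intro prod_mono2) auto
    show "prod ratio R \<le> (\<Prod>p\<in>A. ratio p / c) * c ^ 6"
    proof (rule prod_le_exceptional)
      show "c \<ge> 1" using c by simp
      fix p assume p: "p \<in> R - A"
      then have "real b \<le> real p" using R[of p] by force
      then have "1 / real (p - 1) \<le> 1 / (real b - 1)"
        using c(2) by (intro divide_left_mono mult_pos_pos) auto
      then show "0 \<le> ratio p \<and> ratio p \<le> c" using c by auto
    qed (use A card_R_le[OF k] in \<open>auto simp: R_def\<close>)
  qed (auto intro!: prod_nonneg add_nonneg_nonneg)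
  finally show ?thesis .
qed

text \<open>
  For \<open>k < 3\<^sup>7\<close> at most six prime factors lie outside \<open>{3, 5, 17, 257}\<close>, which makes \<open>C / \<phi>(C)\<close>
  too small. The prime 7 is impossible if \<open>3\<close> divides \<open>C\<close> and 11 is impossible if \<open>5\<close> does,
  because a divisor of \<open>p - 1\<close> divides \<open>k 2\<^sup>N = C - 1\<close>.
\<close>

lemma k_ge_2187: "k \<ge> 2187"
proof (rule ccontr)
  assume "\<not> k \<ge> 2187"
  then have k: "k < 2187" by simp
  have R_cases: "p \<in> {7,11,13,19,23,29}" if "p \<in> R" "p < 31" for p
    using prime_less_31[of p] that S_prime[of p] S_ge_3[of p] by (auto simp: R_def)
  show False
  proof (cases "3 dvd C")
    case True
    then have "3 \<in> S" by (simp add: S_iff)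
    have "7 \<notin> S"
    proof
      assume "7 \<in> S"
      then have "6 dvd k * 2 ^ N" using pred_dvd by force
      then have "3 dvd k * 2 ^ N" by (rule dvd_trans[rotated]) simp
      then show False using S_not_dvd[OF \<open>3 \<in> S\<close>] by simp
    qed
    \<comment> \<open>Without 7, no member of \<open>R\<close> is below 11. The bound is about
      3.54.\<close>
    have "prod ratio S \<le>
        prod ratio {3, 5, 17, 257} * ((\<Prod>p\<in>{}. ratio p / (11 / 10)) * (11 / 10) ^ 6)"
      by (rule prod_ratio_le[OF k, where b = 11])
        (use R_cases \<open>7 \<notin> S\<close> in \<open>force simp: R_def\<close>)+
    then have "prod ratio S < 4" by (simp add: power_divide)
    then show False using less_prod_ratio[OF four_totient_less[OF True]] by simp
  next
    case False
    then have "3 \<notin> S" by (simp add: S_iff)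
    have "prod ratio S < 2"
    proof (cases "5 \<in> S")
      case True
      have "11 \<notin> S"
      proof
        assume "11 \<in> S"
        then have "10 dvd k * 2 ^ N" using pred_dvd by force
        then have "5 dvd k * 2 ^ N" by (rule dvd_trans[rotated]) simp
        then show False using S_not_dvd[OF True] by simp
      qed
      \<comment> \<open>This is the tightest case: the bound is about 1.990. The threshold 31 leaves
        five listed primes and one factor \<open>31 / 30\<close>.\<close>
      have "prod ratio S \<le>
        prod ratio {5, 17, 257} * ((\<Prod>p\<in>{7,13,19,23,29}. ratio p / (31 / 30)) * (31 / 30) ^ 6)"
        by (rule prod_ratio_le[OF k, where b = 31])
          (use R_cases \<open>3 \<notin> S\<close> \<open>11 \<notin> S\<close> in \<open>force simp: R_def\<close>)+
      then show ?thesis by (simp add: power_divide)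
    next
      case False
      have "prod ratio S \<le>
        prod ratio {17, 257} * ((\<Prod>p\<in>{7,11,13,19,23,29}. ratio p / (31 / 30)) * (31 / 30) ^ 6)"
        by (rule prod_ratio_le[OF k, where b = 31])
          (use R_cases \<open>3 \<notin> S\<close> False in \<open>force simp: R_def\<close>)+
      then show ?thesis by (simp add: power_divide)
    qed
    then show False using less_prod_ratio[OF two_totient_less] by simp
  qed
qed

section \<open>Large \<open>k\<close>: the sum of the exponents\<close>

text \<open>Bound each \<open>p\<close> by \<open>2 * (p - 1)\<close>, which costs the extra 1 per
  prime; the product of the \<open>m p\<close> is absorbed by \<open>k\<close>.\<close>

lemma N_less_sum: "N < (\<Sum>p\<in>S. e p + 1)"
proof -
  have "k * 2 ^ N < C" by (simp add: C_def)
  also have "C \<le> (\<Prod>p\<in>S. m p * 2 ^ (e p + 1))"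
    unfolding C_prod
  proof (intro prod_mono conjI)
    fix p assume p: "p \<in> S"
    have "1 \<le> m p * 2 ^ e p" using m_pos[OF p] by simp
    then have "p \<le> 2 * (m p * 2 ^ e p)" using S_eq[OF p] by linarith
    then show "p \<le> m p * 2 ^ (e p + 1)" by (simp add: mult.left_commute)
  qed simp
  also have "\<dots> = prod m S * 2 ^ (\<Sum>p\<in>S. e p + 1)"
    by (simp only: prod.distrib power_sum)
  also have "\<dots> \<le> k * 2 ^ (\<Sum>p\<in>S. e p + 1)" by (intro mult_le_mono1 prod_m_le)
  finally have "2 ^ N < (2::nat) ^ (\<Sum>p\<in>S. e p + 1)" by (metis mult_less_cancel1)
  then show ?thesis by (subst (asm) power_strict_increasing_iff) auto
qed

definition "lam p = log 2 (real (m p))" for p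

lemma lam_nonneg: "p \<in> S \<Longrightarrow> lam p \<ge> 0"
  using m_pos[of p] by (simp add: lam_def)

text \<open>This rests on \<open>3 ^ 2 \<ge> 2 ^ 3\<close>, and will bound the number of primes with
  \<open>m p \<noteq> 1\<close>.\<close>

lemma lam_ge: "p \<in> S \<Longrightarrow> m p \<noteq> 1 \<Longrightarrow> 2 * lam p \<ge> 3"
proof -
  assume p: "p \<in> S" "m p \<noteq> 1"
  have "(3::real) ^ 2 \<le> real (m p) ^ 2" using m_ge_3[OF p] by (intro power_mono) auto
  then have "2 powr 3 \<le> real (m p) ^ 2" by simp
  then have "3 \<le> log 2 (real (m p) ^ 2)" using m_ge_3[OF p] by (subst le_log_iff) auto
  then show ?thesis using m_ge_3[OF p] by (simp add: lam_def log_nat_power)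
qed

lemma sum_lam_le:
  assumes "A \<subseteq> S"
  shows "sum lam A \<le> log 2 (real k)"
proof -
  have "sum lam A \<le> sum lam S" using assms lam_nonneg by (intro sum_mono2) auto
  also have "\<dots> = log 2 (\<Prod>p\<in>S. real (m p))"
    unfolding lam_def log_def using m_pos
    by (subst ln_prod) (force simp: sum_divide_distrib)+
  also have "\<dots> \<le> log 2 (real k)"
  proof -
    have "real (prod m S) > 0" using m_pos by (auto intro!: prod_pos simp: Suc_le_eq)
    moreover have "real (prod m S) \<le> real k" using prod_m_le by (simp only: of_nat_le_iff)
    ultimately show ?thesis by simp
  qed
  finally show ?thesis .
qed

lemma e_le:
  assumes p: "p \<in> S" and "\<not> exceptional p"
  shows "real (e p) \<le> 2 + log 2 (real k) + real (N div e p) * lam p"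
proof -
  have pos: "real (m p) > 0" "real k > 0" using m_pos[OF p] k_pos by auto
  have "real (e p) \<le> log 2 (real (m p) * 2 ^ e p)"
    using pos lam_nonneg[OF p] by (simp add: log_mult log_nat_power lam_def)
  also have "\<dots> \<le> log 2 (2 ^ 2 * real k * real (m p) ^ (N div e p))"
  proof -
    have "real (m p * 2 ^ e p) \<le> real (4 * k * m p ^ (N div e p))"
      using not_exceptional_bound[OF assms] by (simp only: of_nat_le_iff)
    then show ?thesis using pos by simp
  qed
  also have "\<dots> = 2 + log 2 (real k) + real (N div e p) * lam p"
    using pos log_pow_cancel[of 2 2] by (simp add: lam_def log_mult log_nat_power)
  finally show ?thesis .
qed

text \<open>Either \<open>e p\<close> is already small, or \<open>N div e p\<close> is at most
  \<open>N / (3 * l)\<close>. As the \<open>lam p\<close> sum to at most \<open>l\<close>, the last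
  terms together cost at most \<open>N / 3\<close>.\<close>

lemma e_le_linear:
  fixes l :: nat
  assumes p: "p \<in> S" "\<not> exceptional p" and l: "l > 0" "k \<le> 2 ^ l"
  shows "real (e p) \<le> 4 * l + 2 + N / (3 * l) * lam p"
proof (cases "real (e p) \<le> 4 * l + 2")
  case True
  then show ?thesis using lam_nonneg[OF p(1)] by (simp add: add_increasing2)
next
  case False
  have "log 2 (real k) \<le> l" using l k_pos by (intro log2_of_power_le) auto
  have "real (N div e p) \<le> N / e p" by (rule of_nat_div_le_of_nat)
  also have "\<dots> \<le> N / (3 * l)" using False l by (intro divide_left_mono) auto
  finally have "real (N div e p) * lam p \<le> N / (3 * l) * lam p"
    by (intro mult_right_mono lam_nonneg p)
  then show ?thesis using e_le[OF p] \<open>log 2 (real k) \<le> l\<close> by linarith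
qed

text \<open>In the sum of all \<open>e p + 1\<close>, the classes \<open>Z\<close> and
  \<open>U\<close> contribute \<open>N / 3\<close> each, and everything else is at most quadratic in
  \<open>l\<close>. So \<open>N\<close> is less than a quadratic in \<open>l\<close>, although
  \<open>N \<ge> k \<ge> 2 ^ (l - 1)\<close>.\<close>

lemma k_less_2048: "k < 2048"
proof (rule ccontr)
  assume "\<not> k < 2048"
  obtain j where j: "2 ^ j \<le> k" "k < 2 ^ (j + 1)"
    using ex_power_ivl1[of 2 k] k_pos by auto
  define l where "l = j + 1"
  have "(2::nat) ^ 11 < 2 ^ l" using j \<open>\<not> k < 2048\<close> by (simp add: l_def)
  then have l: "l \<ge> 12" by (subst (asm) power_strict_increasing_iff) auto
  have log_k: "log 2 (real k) \<le> l"
    using j k_pos by (intro log2_of_power_le) (auto simp: l_def)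
  define Z where "Z = {p \<in> S. exceptional p}"
  define T where "T = {p \<in> S. \<not> exceptional p \<and> m p = 1}"
  define U where "U = {p \<in> S. \<not> exceptional p \<and> m p \<noteq> 1}"
  have fin: "finite Z" "finite T" "finite U" by (auto simp: Z_def T_def U_def)
  have Z: "(\<Sum>p\<in>Z. real (e p + 1)) \<le> N / 3 + 1"
  proof -
    have "card Z \<le> Suc 0"
      using exceptional_unique fin by (subst card_le_Suc0_iff_eq) (auto simp: Z_def)
    moreover have "(\<Sum>p\<in>Z. real (e p + 1)) \<le> real (card Z) * (N / 3 + 1)"
    proof (rule sum_bounded_above)
      fix p assume "p \<in> Z"
      then have "real (3 * e p) \<le> real N"
        using exceptional_e_le by (simp only: of_nat_le_iff Z_def mem_Collect_eq)
      then show "real (e p + 1) \<le> N / 3 + 1" by simp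
    qed
    ultimately show ?thesis
      by (smt (verit) mult_left_le_one_le of_nat_0_le_iff of_nat_1 One_nat_def of_nat_le_iff
          divide_nonneg_nonneg)
  qed
  have T: "(\<Sum>p\<in>T. real (e p + 1)) \<le> (l + 2) * (l + 3)"
  proof -
    have e_T: "e p \<le> l + 2" if "p \<in> T" for p
      using e_le[of p] that log_k by (simp add: T_def lam_def)
    \<comment> \<open>A prime with \<open>m p = 1\<close> is determined by its exponent, so
      \<open>T\<close> has at most \<open>l + 2\<close> members.\<close>
    have "inj_on e T"
      by (rule inj_onI) (metis (mono_tags, lifting) S_eq T_def mem_Collect_eq)
    moreover have "e ` T \<subseteq> {1..l + 2}" using e_T e_pos by (auto simp: T_def Suc_le_eq)
    ultimately have "card T \<le> card {1..l + 2}" by (intro card_inj_on_le) auto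
    then have "real (card T) \<le> l + 2" by simp
    moreover have "(\<Sum>p\<in>T. real (e p + 1)) \<le> real (card T) * (l + 3)"
      using e_T by (intro sum_bounded_above) (force simp flip: of_nat_Suc)
    ultimately show ?thesis by (smt (verit) mult_right_mono of_nat_0_le_iff of_nat_mult)
  qed
  have U: "(\<Sum>p\<in>U. real (e p + 1)) \<le> 2 / 3 * l * (4 * l + 3) + N / 3"
  proof -
    have lam_U: "sum lam U \<le> l" using sum_lam_le[of U] log_k by (auto simp: U_def)
    have "real (card U) * (3 / 2) \<le> sum lam U"
      using lam_ge by (intro sum_bounded_below) (force simp: U_def)
    then have card: "real (card U) \<le> 2 / 3 * l" using lam_U by simp
    have "(\<Sum>p\<in>U. real (e p + 1)) \<le> (\<Sum>p\<in>U. (4 * l + 3) + N / (3 * l) * lam p)"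
    proof (rule sum_mono)
      fix p assume "p \<in> U"
      then have "real (e p) \<le> 4 * l + 2 + N / (3 * l) * lam p"
        using j l by (intro e_le_linear) (auto simp: U_def l_def)
      then show "real (e p + 1) \<le> real (4 * l + 3) + N / (3 * l) * lam p" by simp
    qed
    also have "\<dots> = real (card U) * (4 * l + 3) + N / (3 * l) * sum lam U"
      by (simp add: sum.distrib sum_distrib_left)
    also have "\<dots> \<le> 2 / 3 * l * (4 * l + 3) + N / (3 * l) * l"
      using card lam_U by (intro add_mono mult_right_mono mult_left_mono) auto
    finally show ?thesis using l by simp
  qed
  have "real N < (\<Sum>p\<in>S. real (e p + 1))"
    using N_less_sum by (simp only: of_nat_less_iff flip: of_nat_sum)
  also have "S = Z \<union> (T \<union> U)" by (auto simp: Z_def T_def U_def)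
  also have "(\<Sum>p\<in>Z \<union> (T \<union> U). real (e p + 1)) =
      (\<Sum>p\<in>Z. real (e p + 1)) + ((\<Sum>p\<in>T. real (e p + 1)) + (\<Sum>p\<in>U. real (e p + 1)))"
    using fin by (subst sum.union_disjoint; (subst sum.union_disjoint)?)
      (auto simp: Z_def T_def U_def)
  finally have "real N < 11 * real l ^ 2 + 21 * real l + 21"
    using Z T U by (simp add: algebra_simps power2_eq_square)
  then have "real N < real (11 * l ^ 2 + 21 * l + 21)" by simp
  then have "N < 11 * l ^ 2 + 21 * l + 21" by (simp only: of_nat_less_iff)
  then show False using quadratic_less_power[OF l] j k_le_N by (simp add: l_def)
qed

lemma contradiction: False
  using k_ge_2187 k_less_2048 by simp

end

theorem theorem1:
  fixes n :: nat
  assumes "n \<ge> 1"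
    and "totient (cullen n) dvd cullen n - 1"
  shows "prime (cullen n)"
proof (rule ccontr)
  assume not_prime: "\<not> prime (cullen n)"
  obtain a k where n: "n = 2 ^ a * k" and "odd k"
  proof (rule multiplicity_decompose'[of n 2])
    show "n \<noteq> 0" "\<not> is_unit (2::nat)" using \<open>n \<ge> 1\<close> by simp_all
  qed
  \<comment> \<open>The power of 2 in \<open>n\<close> joins \<open>2 ^ n\<close>, which leaves
    \<open>k \<le> n \<le> N\<close>.\<close>
  define N where "N = n + a"
  have C: "cullen n = k * 2 ^ N + 1"
    using n by (simp add: cullen_def N_def power_add)
  have "k \<le> n" using n by simp
  then interpret lehmer_proth k N
    using \<open>odd k\<close> assms(2) not_prime unfolding C by unfold_locales (simp_all add: N_def)
  show False by (rule contradiction)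
qed

end
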